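(* Let $\mathcal{F}$ be a non-piercing family of regions in the plane. Then $\lambda(\mathcal{F})\le 4$, i.e., there do not exist five sets $F_1,\dots,F_5\in\mathcal{F}$ such that for every pair $\{i,j\}\subseteq\{1,\dots,5\}$ with $i\neq j$ there is a point $a_{i,j}\in F_i\cap F_j$ with $a_{i,j}\notin F_k$ for all $k\in\{1,\dots,5\}\setminus\{i,j\}$.
   Context: A region is a connected, compact subset of the plane whose boundary consists of finitely many disjoint Jordan curves. A family $\mathcal{F}$ of regions is non-piercing if for any two regions $F,G\in\mathcal{F}$ the difference $F\setminus G$ is connected. For a set system $\mathcal{F}$, the dyadic dual VC-dimension $\lambda(\mathcal{F})$ is the largest integer $\ell$ such that there exist sets $F_1,\dots,F_\ell\in\mathcal{F}$ such that for every pair $\{i,j\}$ of distinct indices in $\{1,\dots,\ell\}$ there exists an element $a_{i,j}\in F_i\cap F_j$ with $a_{i,j}\notin F_k$ for every $k\in\{1,\dots,\ell\}\setminus\{i,j\}$. *)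

theory Defs
  imports "HOL-Analysis.Analysis"
begin

definition jordan_curve :: "complex set \<Rightarrow> bool" where
  "jordan_curve C \<longleftrightarrow> (\<exists>g. simple_path g \<and> pathfinish g = pathstart g \<and> path_image g = C)"

definition region :: "complex set \<Rightarrow> bool" where
  "region R \<longleftrightarrow> connected R \<and> compact R \<and>
     (\<exists>\<C>. finite \<C> \<and> (\<forall>C\<in>\<C>. jordan_curve C) \<and>
          (\<forall>C\<in>\<C>. \<forall>D\<in>\<C>. C \<noteq> D \<longrightarrow> C \<inter> D = {}) \<and>
          frontier R = \<Union>\<C>)"

definition non_piercing :: "complex set set \<Rightarrow> bool" where
  "non_piercing \<F> \<longleftrightarrow> (\<forall>F\<in>\<F>. \<forall>G\<in>\<F>. connected (F - G))"

definition dyadic_witness :: "'a set set \<Rightarrow> nat \<Rightarrow> bool" where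
  "dyadic_witness \<F> l \<longleftrightarrow> (\<exists>F :: nat \<Rightarrow> 'a set. (\<forall>i<l. F i \<in> \<F>) \<and>
     (\<forall>i<l. \<forall>j<l. i \<noteq> j \<longrightarrow>
        (\<exists>a. a \<in> F i \<and> a \<in> F j \<and> (\<forall>k<l. k \<noteq> i \<and> k \<noteq> j \<longrightarrow> a \<notin> F k))))"

end

theory Submission
  imports Defs "HOL-Complex_Analysis.Complex_Analysis"
begin

text \<open>
  Five such regions would give a drawing of \<open>K\<^sub>5\<close>: the star of vertex \<open>i\<close> is drawn inside \<open>F\<^sub>i\<close> and the
  edge \<open>i j\<close> passes through the common point \<open>c\<^sub>i\<^sub>j\<close>. By the van Kampen argument the number of
  crossings of disjoint edges is odd in every drawing. On the other hand, a path in \<open>F\<^sub>i\<close> and a path in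
  \<open>F\<^sub>k\<close>, with end points outside the other region, have algebraic intersection number 0, because
  the first can be rerouted inside \<open>F\<^sub>i - F\<^sub>k\<close>, so the number of crossings is even.

  No general position is needed, since the intersection number of two paths \<open>p\<close> and \<open>q\<close> is expressed by
  winding numbers of \<open>p\<close> around the end points of \<open>q\<close> and vice versa. The vertices themselves may
  lie in other regions, so only paths joining two of the points \<open>c\<^sub>i\<^sub>j\<close> within the same \<open>F\<^sub>i\<close> are
  intersected. Modulo 1 these winding numbers are differences of arguments, and the oddness
  of the total comes from \<open>arg (x - y)\<close> and \<open>arg (y - x)\<close> differing by half a turn.

  The argument applies to all path-connected sets with path-connected differences. Regions qualify
  because a closed set whose frontier is locally path-connected is itself locally path-connected.
\<close>

section \<open>Local path-connectedness of regions\<close>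

lemma locally_path_connected_path_image:
  fixes g :: "real \<Rightarrow> 'a::real_normed_vector"
  assumes "path g"
  shows "locally path_connected (path_image g)"
  unfolding path_image_def
proof (rule locally_path_connected_quotient_image)
  show "locally path_connected {0..1::real}"
    by (simp add: convex_imp_locally_path_connected)
  have cont: "continuous_on {0..1} g"
    using assms by (simp add: path_def)
  fix T assume "T \<subseteq> g ` {0..1}"
  then show "openin (top_of_set {0..1}) ({0..1} \<inter> g -` T) \<longleftrightarrow> openin (top_of_set (g ` {0..1})) T"
    by (intro Abstract_Topology_2.continuous_imp_quotient_map[OF cont]) auto
qed

lemma locally_path_connected_disjoint_Union:
  fixes \<C> :: "'a::real_normed_vector set set"
  assumes "finite \<C>" "disjoint \<C>"
    and closed: "\<And>C. C \<in> \<C> \<Longrightarrow> closed C"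
    and lpc: "\<And>C. C \<in> \<C> \<Longrightarrow> locally path_connected C"
  shows "locally path_connected (\<Union>\<C>)"
  unfolding locally_path_connected
proof (intro allI impI, elim conjE)
  fix V x assume V: "openin (top_of_set (\<Union>\<C>)) V" and "x \<in> V"
  then obtain C where C: "C \<in> \<C>" "x \<in> C"
    using openin_imp_subset by blast
  have "closed (\<Union>(\<C> - {C}))"
    using assms by (intro closed_Union) auto
  moreover have "C = \<Union>\<C> - \<Union>(\<C> - {C})"
    using C \<open>disjoint \<C>\<close> by (fastforce simp: disjoint_def)
  ultimately have opC: "openin (top_of_set (\<Union>\<C>)) C"
    by (metis Diff_eq open_Compl openin_open_Int)
  have "openin (top_of_set C) (C \<inter> V)"
    using V C(1) by (auto simp: openin_open)
  then obtain U where "openin (top_of_set C) U" "path_connected U" "x \<in> U" "U \<subseteq> C \<inter> V"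
    using lpc[OF C(1)] C(2) \<open>x \<in> V\<close> unfolding locally_path_connected by blast
  then show "\<exists>U. openin (top_of_set (\<Union>\<C>)) U \<and> path_connected U \<and> x \<in> U \<and> U \<subseteq> V"
    using opC openin_trans by blast
qed

text \<open>Near a frontier point \<open>x\<close>, a point \<open>y\<close> of \<open>S\<close> is
  joined to \<open>x\<close> by following the segment towards \<open>x\<close> up to the first
  frontier point and continuing inside a small path-connected part \<open>W\<close> of the frontier.
  This shows the im-kleinen form, which suffices when it holds at all points.\<close>

lemma locally_path_connected_from_frontier:
  fixes S :: "'a::euclidean_space set"
  assumes "closed S" and lpc: "locally path_connected (frontier S)"
  shows "locally path_connected S"
  unfolding locally_path_connected_im_kleinen
proof (intro allI impI, elim conjE)
  fix V x assume V: "openin (top_of_set S) V" and "x \<in> V"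
  then obtain e where e: "e > 0" "ball x e \<inter> S \<subseteq> V" and "x \<in> S"
    by (metis open_contains_ball inf_commute openin_open Int_iff Int_mono subset_refl)
  show "\<exists>U. openin (top_of_set S) U \<and> x \<in> U \<and> U \<subseteq> V \<and>
          (\<forall>y. y \<in> U \<longrightarrow> (\<exists>p. path p \<and> path_image p \<subseteq> V \<and> pathstart p = x \<and> pathfinish p = y))"
  proof (cases "x \<in> interior S")
    case True
    then obtain d where d: "d > 0" "ball x d \<subseteq> S"
      by (meson mem_interior)
    have "ball x (min d e) \<subseteq> V"
      using d(2) e(2) by (fastforce simp: subset_iff)
    moreover have "path_component (ball x (min d e)) x y" if "y \<in> ball x (min d e)" for y
      using that d e path_connected_component convex_imp_path_connected[OF convex_ball]
      by (metis centre_in_ball min_less_iff_conj)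
    moreover have "openin (top_of_set S) (ball x (min d e))"
      using d(2) by (intro open_subset) auto
    ultimately show ?thesis
      using d(1) e(1) unfolding path_component_def
      by (intro exI[of _ "ball x (min d e)"]) (simp; blast)
  next
    case False
    then have xfr: "x \<in> frontier S"
      using \<open>x \<in> S\<close> \<open>closed S\<close> by (simp add: frontier_def)
    have frS: "frontier S \<subseteq> S"
      using \<open>closed S\<close> by (simp add: frontier_subset_closed)
    have "openin (top_of_set (frontier S)) (frontier S \<inter> ball x e)"
      by (simp add: openin_open_Int)
    then obtain W where W: "openin (top_of_set (frontier S)) W" "path_connected W" "x \<in> W"
        "W \<subseteq> frontier S \<inter> ball x e"
      using lpc xfr e unfolding locally_path_connected by (metis Int_iff centre_in_ball)
    then obtain d where d: "d > 0" "ball x d \<inter> frontier S \<subseteq> W" 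
      by (metis open_contains_ball inf_commute openin_open Int_iff Int_mono subset_refl)
    define r where "r = min d e"
    have r: "r > 0" "ball x r \<inter> frontier S \<subseteq> W" "ball x r \<inter> S \<subseteq> V"
      using d e by (auto simp: r_def)
    have WV: "W \<subseteq> V"
      using W e frS by blast
    have "path_component V x y" if y: "y \<in> S" "y \<in> ball x r" for y
    proof -
      have sub: "closed_segment y x \<subseteq> ball x r"
        using y r by (intro closed_segment_subset) auto
      show ?thesis
      proof (cases "y \<in> frontier S")
        case True
        then have "path_component W x y"
          using W y r path_connected_component by (metis Int_iff subsetD)
        then show ?thesis
          using WV path_component_of_subset by blast
      next
        case False
        then have yint: "y \<in> interior S"
          using y \<open>closed S\<close> by (simp add: frontier_def)
        then have "pathstart (linepath y x) \<in> closure (interior S)"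
          using closure_subset by fastforce
        then obtain h where h: "path h" "pathstart h = y" "path_image h \<subseteq> closed_segment y x"
            "path_image h - {pathfinish h} \<subseteq> interior (interior S)" "pathfinish h \<in> frontier (interior S)"
          using exists_path_subpath_to_frontier[of "linepath y x" "interior S"] \<open>x \<notin> interior S\<close>
          by (metis path_linepath pathstart_linepath pathfinish_linepath path_image_linepath)
        have fin: "pathfinish h \<in> W"
          using h(3,5) sub r(2) frontier_interior_subset[of S] pathfinish_in_path_image[of h] by blast
        have "path_image h - {pathfinish h} \<subseteq> S \<inter> ball x r"
          using h(3,4) sub interior_subset[of S] by auto
        then have "path_image h \<subseteq> V"
          using fin WV r(3) by auto
        then have "path_component V y (pathfinish h)"
          using h(1,2) path_component_def by blast
        moreover have "path_component V x (pathfinish h)"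
          using W fin WV by (metis path_component_of_subset path_connected_component)
        ultimately show ?thesis
          using path_component_sym path_component_trans by blast
      qed
    qed
    then show ?thesis
      using r \<open>x \<in> S\<close>
      by (intro exI[of _ "S \<inter> ball x r"]) (auto simp: path_component_def openin_open_Int)
  qed
qed

lemma path_connected_iff_connected:
  fixes S :: "'a::real_normed_vector set"
  assumes "locally path_connected S"
  shows "path_connected S \<longleftrightarrow> connected S"
  using path_component_eq_connected_component[OF assms]
  by (simp add: path_connected_component connected_iff_connected_component)

lemma region_locally_path_connected:
  assumes "region R"
  shows "locally path_connected R"
proof -
  obtain \<C> where \<C>: "finite \<C>" "\<forall>C\<in>\<C>. jordan_curve C" "disjoint \<C>" "frontier R = \<Union>\<C>" and "compact R"
    using assms unfolding region_def disjoint_def by metis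
  have "closed C" "locally path_connected C" if "C \<in> \<C>" for C
    using \<C>(2) that locally_path_connected_path_image closed_path_image simple_path_imp_path
    unfolding jordan_curve_def by metis+
  then have "locally path_connected (frontier R)"
    using \<C> locally_path_connected_disjoint_Union by metis
  then show ?thesis
    using \<open>compact R\<close> locally_path_connected_from_frontier compact_imp_closed by blast
qed

lemma region_path_connected:
  assumes "region R"
  shows "path_connected R"
  using assms path_connected_iff_connected region_locally_path_connected region_def by blast

lemma region_diff_path_connected:
  assumes "region F" "region G" "connected (F - G)"
  shows "path_connected (F - G)"
proof -
  have "openin (top_of_set F) (F - G)"
    using \<open>region G\<close> by (simp add: region_def Diff_eq compact_imp_closed open_Compl openin_open_Int)
  then have "locally path_connected (F - G)"
    using locally_open_subset region_locally_path_connected[OF \<open>region F\<close>] by blast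
  then show ?thesis
    using assms(3) path_connected_iff_connected by blast
qed

section \<open>Winding numbers of pairs of paths\<close>

text \<open>The difference of the two sides is the winding number about 0 of the boundary of the square under
  \<open>(s, t) \<mapsto> p s - q t\<close>, which is an algebraic intersection number of \<open>p\<close> and \<open>q\<close>.\<close>

lemma winding_number_sum_disjoint_paths:
  assumes "path p" "path q" and disj: "path_image p \<inter> path_image q = {}"
  shows "winding_number p (pathstart q) - winding_number p (pathfinish q) =
         winding_number q (pathstart p) - winding_number q (pathfinish p)"
proof -
  let ?S = "{0..1::real} \<times> {0..1::real}"
  define f where "f = (\<lambda>x. p (fst x) - q (snd x))"
  have contf: "continuous_on ?S f"
  proof -
    have "continuous_on ?S (\<lambda>x. p (fst x))"
      using assms by (intro continuous_on_compose2[of "{0..1}" p _ fst] continuous_on_fst) (auto simp: path_def)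
    moreover have "continuous_on ?S (\<lambda>x. q (snd x))"
      using assms by (intro continuous_on_compose2[of "{0..1}" q _ snd] continuous_on_snd) (auto simp: path_def)
    ultimately show ?thesis
      unfolding f_def by (rule continuous_on_diff)
  qed
  have nz: "f x \<noteq> 0" if "x \<in> ?S" for x
    using that disj by (auto simp: f_def path_image_def)
  \<comment> \<open>One logarithm of \<open>p s - q t\<close> on the whole square: all four winding
    numbers become differences of its corner values.\<close>
  obtain g where contg: "continuous_on ?S g" and g: "\<And>x. x \<in> ?S \<Longrightarrow> f x = exp (g x)"
    using continuous_logarithm_on_contractible[OF contf _ nz]
    by (metis convex_Times convex_closed_interval(1) convex_imp_contractible convex_real_interval(5))
  have p: "winding_number p (q t) = (g (1, t) - g (0, t)) / (2 * pi * \<i>)" if t: "t \<in> {0..1}" for t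
  proof -
    have "path (\<lambda>s. g (s, t))"
      unfolding path_def using t
      by (intro continuous_on_compose2[OF contg] continuous_intros) auto
    then have "winding_number (exp \<circ> (\<lambda>s. g (s, t))) 0 = (g (1, t) - g (0, t)) / (2 * pi * \<i>)"
      by (simp add: winding_number_compose_exp pathstart_def pathfinish_def)
    moreover have "winding_number (exp \<circ> (\<lambda>s. g (s, t))) 0 = winding_number (\<lambda>s. p s - q t) 0"
      using g t by (intro winding_number_cong) (auto simp: f_def)
    ultimately show ?thesis
      using winding_number_offset[of p "q t"] by simp
  qed
  have q: "winding_number q (p s) = (g (s, 1) - g (s, 0)) / (2 * pi * \<i>)" if s: "s \<in> {0..1}" for s
  proof -
    \<comment> \<open>Adding \<open>\<i> * pi\<close> to the logarithm turns
      \<open>p s - q t\<close> into \<open>q t - p s\<close>.\<close>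
    have "path (\<lambda>t. g (s, t) + \<i> * pi)"
      unfolding path_def using s
      by (intro continuous_on_compose2[OF contg] continuous_intros) auto
    then have "winding_number (exp \<circ> (\<lambda>t. g (s, t) + \<i> * pi)) 0 = (g (s, 1) - g (s, 0)) / (2 * pi * \<i>)"
      by (simp add: winding_number_compose_exp pathstart_def pathfinish_def)
    moreover have "winding_number (exp \<circ> (\<lambda>t. g (s, t) + \<i> * pi)) 0 = winding_number (\<lambda>t. q t - p s) 0"
      using g s by (intro winding_number_cong) (auto simp: f_def exp_add algebra_simps)
    ultimately show ?thesis
      using winding_number_offset[of q "p s"] by simp
  qed
  show ?thesis
    using p[of 0] p[of 1] q[of 0] q[of 1]
    by (simp add: pathstart_def pathfinish_def diff_divide_distrib)
qed

lemma winding_number_reversepath_join: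
  assumes "path p" "path q" "pathstart p = pathstart q" "z \<notin> path_image p" "z \<notin> path_image q"
  shows "winding_number (reversepath p +++ q) z = winding_number q z - winding_number p z"
  using assms by (simp add: winding_number_join winding_number_reversepath)

text \<open>The path \<open>p\<close> may be rerouted through \<open>F - G\<close>, away from \<open>q\<close>. This does not change the left-hand
  side, since the loop formed by the old and the new path lies in \<open>F\<close> and thus winds equally often
  around all points of \<open>G - F\<close>.\<close>

lemma winding_number_sum_non_piercing:
  fixes F G :: "complex set"
  assumes p: "path p" "path_image p \<subseteq> F" "pathstart p \<notin> G" "pathfinish p \<notin> G"
    and q: "path q" "path_image q \<subseteq> G" "pathstart q \<notin> F" "pathfinish q \<notin> F"
    and FG: "path_connected (F - G)" and GF: "connected (G - F)"
  shows "winding_number p (pathstart q) - winding_number p (pathfinish q) =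
         winding_number q (pathstart p) - winding_number q (pathfinish p)"
proof -
  have "pathstart p \<in> F - G" "pathfinish p \<in> F - G"
    using p by auto
  then obtain p' where p': "path p'" "path_image p' \<subseteq> F - G"
      "pathstart p' = pathstart p" "pathfinish p' = pathfinish p"
    using FG unfolding path_connected_def by metis
  define l where "l = reversepath p' +++ p"
  have wl: "winding_number l z = winding_number p z - winding_number p' z" if "z \<notin> F" for z
    unfolding l_def using that p p' by (intro winding_number_reversepath_join) auto
  have "winding_number l constant_on (G - F)"
    using p p' by (intro winding_number_constant GF) (auto simp: l_def path_image_join)
  moreover have "pathstart q \<in> G - F" "pathfinish q \<in> G - F"
    using q by auto
  ultimately have "winding_number l (pathstart q) = winding_number l (pathfinish q)"
    unfolding constant_on_def by metis
  then have "winding_number p (pathstart q) - winding_number p' (pathstart q) =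
      winding_number p (pathfinish q) - winding_number p' (pathfinish q)"
    using q by (simp add: wl)
  moreover have "winding_number p' (pathstart q) - winding_number p' (pathfinish q) =
      winding_number q (pathstart p) - winding_number q (pathfinish p)"
    unfolding p'(3,4)[symmetric] using p'(2) q(2) by (intro winding_number_sum_disjoint_paths p' q) auto
  ultimately show ?thesis
    by algebra
qed

text \<open>The real part is the argument in full turns. The imaginary part, from the modulus,
  matches the complex winding numbers of open paths.\<close>

definition arg_turns :: "complex \<Rightarrow> complex" where
  "arg_turns z = Ln z / (2 * pi * \<i>)"

lemma winding_number_arg_turns:
  assumes "path p" "z \<notin> path_image p"
  shows "\<exists>n::int. winding_number p z = arg_turns (pathfinish p - z) - arg_turns (pathstart p - z) + of_int n"
proof -
  have "exp (2 * pi * \<i> * winding_number p z + Ln (pathstart p - z)) = exp (Ln (pathfinish p - z))"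
    using winding_number_exp_2pi[OF assms] assms pathstart_in_path_image[of p] pathfinish_in_path_image[of p]
    by (metis eq_iff_diff_eq_0 exp_Ln exp_add)
  then obtain n :: int where
    "2 * pi * \<i> * winding_number p z + Ln (pathstart p - z) =
     Ln (pathfinish p - z) + of_int (2 * n) * pi * \<i>"
    unfolding exp_eq by auto
  then have "2 * pi * \<i> * winding_number p z =
      Ln (pathfinish p - z) - Ln (pathstart p - z) + 2 * pi * \<i> * of_int n"
    by (simp add: algebra_simps)
  then have "winding_number p z =
      (Ln (pathfinish p - z) - Ln (pathstart p - z) + 2 * pi * \<i> * of_int n) / (2 * pi * \<i>)"
    by (simp add: eq_divide_eq mult.commute)
  then show ?thesis
    by (intro exI[of _ n]) (simp add: arg_turns_def add_divide_distrib diff_divide_distrib)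
qed

lemma arg_turns_uminus:
  assumes "z \<noteq> 0"
  shows "\<exists>n::int. arg_turns z - arg_turns (- z) = 1 / 2 + of_int n"
proof -
  have "arg_turns z - arg_turns (- z) = - 1 / 2 \<or> arg_turns z - arg_turns (- z) = 1 / 2"
    using Ln_minus[OF assms] by (simp add: arg_turns_def field_simps)
  then show ?thesis
  proof
    assume "arg_turns z - arg_turns (- z) = - 1 / 2"
    then show ?thesis
      by (intro exI[of _ "- 1"]) simp
  next
    assume "arg_turns z - arg_turns (- z) = 1 / 2"
    then show ?thesis
      by (intro exI[of _ 0]) simp
  qed
qed

section \<open>Parity count for the complete graph on five vertices\<close>

text \<open>In terms of a drawing of \<open>K\<^sub>5\<close> whose edge \<open>i j\<close> passes through a point \<open>c i j\<close>, \<open>D i j k l\<close>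
  has the parity of the contribution of the pair \<open>(c i j, c k l)\<close> to the number of crossings between
  the half-edges at \<open>i\<close> and at \<open>k\<close>. The parity of the sum \<open>X\<close> is that of the number of crossings between
  those half-edges of the stars at \<open>i\<close> and \<open>k\<close> that belong to disjoint edges; \<open>Q\<close> regroups the same summands
  by four-element vertex sets, each of which contributes an odd number.\<close>

lemma K5_parity:
  fixes N m :: "nat \<Rightarrow> nat \<Rightarrow> nat \<Rightarrow> nat \<Rightarrow> int"
  assumes N: "\<And>i j k l. N i j k l = N i j l k"
    and m: "\<And>i j k l. m i j k l = m j i k l" "\<And>i j k l. m i j k l = m i j l k"
    and m_odd: "\<And>i j k l. distinct [i, j, k, l] \<Longrightarrow> {i, j, k, l} \<subseteq> {..<5} \<Longrightarrow>
       odd (m i j k l + m k l i j)"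
    and D: "\<And>i j k l. D i j k l = N i j k l + N k l i j + m i j k l"
    and D_even: "\<And>i k j j' l l'. i \<noteq> k \<Longrightarrow> {i, k} \<inter> {j, j', l, l'} = {} \<Longrightarrow>
       {i, k, j, j', l, l'} \<subseteq> {..<5} \<Longrightarrow>
       even (D i j' k l + D i j k l + D i j' k l' + D i j k l')"
  shows False
proof -
  define X where
    "X i k p q r = D i p k q + D i p k r + D i q k p + D i q k r + D i r k p + D i r k q" for i k p q r
  define Q where
    \<comment> \<open>For a < b < c < d, these are the terms \<open>D x y z w\<close> on these
      vertices with x < z, one row per splitting into two disjoint edges.\<close>
    "Q a b c d = (D a b c d + D a b d c + D b a c d + D b a d c) +
      (D a c b d + D a c d b + D c a d b + D b d c a) +
      (D a d b c + D a d c b + D b c d a + D c b d a)" for a b c d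
  have X_even: "even (X i k p q r)" if "distinct [i, k, p, q, r]" "{i, k, p, q, r} \<subseteq> {..<5}" for i k p q r
    \<comment> \<open>The two instances add up to
      \<open>X i k p q r + 2 * D i r k r\<close>.\<close>
    using D_even[of i k q r r p] D_even[of i k r p r q] that unfolding X_def by auto
  have Q_odd: "odd (Q a b c d)" if "distinct [a, b, c, d]" "{a, b, c, d} \<subseteq> {..<5}" for a b c d
  proof -
    let ?n = "N a b c d + N b a c d + N c d a b + N d c a b + N a c b d + N c a b d +
        N b d a c + N d b a c + N a d b c + N d a b c + N b c a d + N c b a d"
    \<comment> \<open>Each \<open>N\<close> occurs twice. Only the interleaved splitting ac|bd is
      unbalanced: \<open>m\<close> occurs three times in one order and once in the other.\<close>
    have "Q a b c d = 2 * (?n + 2 * m a b c d + m a c b d + m a d b c + m b c a d) + (m a c b d + m b d a c)"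
      unfolding Q_def D
      using N[of _ _ b a] N[of _ _ c a] N[of _ _ d a] N[of _ _ c b] N[of _ _ d b] N[of _ _ d c]
        m[of b a] m[of c a] m[of d a] m[of c b] m[of d b] m[of d c]
        m(2)[of _ _ b a] m(2)[of _ _ c a] m(2)[of _ _ d a] m(2)[of _ _ c b] m(2)[of _ _ d b] m(2)[of _ _ d c]
      by simp
    then show ?thesis
      using m_odd[of a c b d] that by auto
  qed
  have "even (X 0 1 2 3 4 + X 0 2 1 3 4 + X 0 3 1 2 4 + X 0 4 1 2 3 + X 1 2 0 3 4 +
      X 1 3 0 2 4 + X 1 4 0 2 3 + X 2 3 0 1 4 + X 2 4 0 1 3 + X 3 4 0 1 2)"
    by (intro dvd_add X_even) auto
  also have "X 0 1 2 3 4 + X 0 2 1 3 4 + X 0 3 1 2 4 + X 0 4 1 2 3 + X 1 2 0 3 4 +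
      X 1 3 0 2 4 + X 1 4 0 2 3 + X 2 3 0 1 4 + X 2 4 0 1 3 + X 3 4 0 1 2 =
      Q 0 1 2 3 + Q 0 1 2 4 + Q 0 1 3 4 + Q 0 2 3 4 + Q 1 2 3 4"
    unfolding X_def Q_def by simp
  finally show False
    using Q_odd[of 0 1 2 3] Q_odd[of 0 1 2 4] Q_odd[of 0 1 3 4] Q_odd[of 0 2 3 4] Q_odd[of 1 2 3 4] by simp
qed

section \<open>Contradiction from five sets\<close>

lemma no_five_non_piercing_sets:
  fixes F :: "nat \<Rightarrow> complex set" and c :: "nat \<Rightarrow> nat \<Rightarrow> complex"
  assumes pc: "\<And>i. i < 5 \<Longrightarrow> path_connected (F i)"
    and pc_diff: "\<And>i j. i < 5 \<Longrightarrow> j < 5 \<Longrightarrow> path_connected (F i - F j)"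
    and c_sym: "\<And>i j. c i j = c j i"
    and c_in: "\<And>i j. i < 5 \<Longrightarrow> j < 5 \<Longrightarrow> i \<noteq> j \<Longrightarrow> c i j \<in> F i"
    and c_notin: "\<And>i j k. i < 5 \<Longrightarrow> j < 5 \<Longrightarrow> k < 5 \<Longrightarrow> i \<noteq> j \<Longrightarrow> k \<noteq> i \<Longrightarrow> k \<noteq> j \<Longrightarrow> c i j \<notin> F k"
  shows False
proof -
  \<comment> \<open>The centre of the star of \<open>i\<close>, an arbitrary point of
    \<open>F i\<close>; the index 1 or 0 merely has to differ from \<open>i\<close>.\<close>
  define b where "b i = c i (if i = 0 then 1 else 0)" for i :: nat
  have "\<exists>p. path p \<and> path_image p \<subseteq> F i \<and> pathstart p = b i \<and> pathfinish p = c i j"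
    if "i < 5" "j < 5" "i \<noteq> j" for i j
    using pc[OF that(1)] c_in[OF that] c_in[of i "if i = 0 then 1 else 0"] that(1)
    unfolding path_connected_def b_def by simp
  then obtain P where P: "\<And>i j. i < 5 \<Longrightarrow> j < 5 \<Longrightarrow> i \<noteq> j \<Longrightarrow>
      path (P i j) \<and> path_image (P i j) \<subseteq> F i \<and> pathstart (P i j) = b i \<and> pathfinish (P i j) = c i j"
    by metis
  define w where "w i j k l = winding_number (P i j) (c k l)" for i j k l
  have avoid: "c k l \<notin> path_image (P i j)"
    if "i < 5" "j < 5" "k < 5" "l < 5" "i \<noteq> j" "i \<noteq> k" "i \<noteq> l" "k \<noteq> l" for i j k l
    using P[of i j] c_notin[of k l i] that by auto
  \<comment> \<open>Choosing by \<open>SOME\<close> makes \<open>N\<close> inherit the symmetry of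
    \<open>c\<close>, as the predicate does not change when \<open>k\<close> and \<open>l\<close>
    are swapped.\<close>
  define N where "N i j k l = (SOME n::int.
      w i j k l = arg_turns (c i j - c k l) - arg_turns (b i - c k l) + of_int n)" for i j k l
  have N_sym: "N i j k l = N i j l k" for i j k l
    unfolding N_def w_def c_sym[of k l] ..
  have w: "w i j k l = arg_turns (c i j - c k l) - arg_turns (b i - c k l) + of_int (N i j k l)"
    if "i < 5" "j < 5" "k < 5" "l < 5" "i \<noteq> j" "i \<noteq> k" "i \<noteq> l" "k \<noteq> l" for i j k l
    unfolding N_def
    using winding_number_arg_turns[of "P i j" "c k l"] P[of i j] avoid[OF that] that
    by (intro someI_ex[where P = "\<lambda>n. _ n = _ n + of_int n"]) (simp add: w_def)
  define m where "m i j k l = (SOME n::int.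
      arg_turns (c i j - c k l) - arg_turns (c k l - c i j) = 1 / 2 + of_int n)" for i j k l
  have m_sym: "m i j k l = m j i k l" "m i j k l = m i j l k" for i j k l
    unfolding m_def by (simp_all only: c_sym[of i j] c_sym[of k l])
  have m: "arg_turns (c i j - c k l) - arg_turns (c k l - c i j) = 1 / 2 + of_int (m i j k l)"
    if "i < 5" "j < 5" "k < 5" "l < 5" "i \<noteq> j" "i \<noteq> k" "i \<noteq> l" "k \<noteq> l" for i j k l
  proof -
    have "c i j - c k l \<noteq> 0"
      using c_in[of i j] c_notin[of k l i] that by auto
    then show ?thesis
      using someI_ex[OF arg_turns_uminus[of "c i j - c k l"]] by (simp add: m_def)
  qed
  define D where "D i j k l = N i j k l + N k l i j + m i j k l" for i j k l
  show False
  proof (rule K5_parity[where N = N and m = m and D = D])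
    show "odd (m i j k l + m k l i j)" if "distinct [i, j, k, l]" "{i, j, k, l} \<subseteq> {..<5}" for i j k l
    proof -
      have "of_int (m i j k l + m k l i j + 1) = (of_int 0 :: complex)"
        using m[of i j k l] m[of k l i j] that by (simp add: algebra_simps)
      then have "m i j k l + m k l i j + 1 = 0"
        by (simp only: of_int_eq_iff)
      then show ?thesis
        by presburger
    qed
    show "even (D i j' k l + D i j k l + D i j' k l' + D i j k l')"
      if ne: "i \<noteq> k" "{i, k} \<inter> {j, j', l, l'} = {}" "{i, k, j, j', l, l'} \<subseteq> {..<5}" for i k j j' l l'
    proof -
      define p where "p = reversepath (P i j) +++ P i j'"
      define q where "q = reversepath (P k l) +++ P k l'"
      have p: "path p" "path_image p \<subseteq> F i" "pathstart p = c i j" "pathfinish p = c i j'"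
        using P[of i j] P[of i j'] ne by (auto simp: p_def path_image_join)
      have q: "path q" "path_image q \<subseteq> F k" "pathstart q = c k l" "pathfinish q = c k l'"
        using P[of k l] P[of k l'] ne by (auto simp: q_def path_image_join)
      have wp: "winding_number p (c k t) = w i j' k t - w i j k t" if "t \<in> {l, l'}" for t
        unfolding p_def w_def using P avoid ne that by (intro winding_number_reversepath_join) auto
      have wq: "winding_number q (c i t) = w k l' i t - w k l i t" if "t \<in> {j, j'}" for t
        unfolding q_def w_def using P avoid ne that by (intro winding_number_reversepath_join) auto
      have "winding_number p (pathstart q) - winding_number p (pathfinish q) =
          winding_number q (pathstart p) - winding_number q (pathfinish p)"
        using p q ne pc_diff[of i k] path_connected_imp_connected[OF pc_diff[of k i]]
          c_notin[of i j k] c_notin[of i j' k] c_notin[of k l i] c_notin[of k l' i]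
        by (intro winding_number_sum_non_piercing[of p "F i" "F k" q]) auto
      then have eq: "(w i j' k l - w i j k l) - (w i j' k l' - w i j k l') =
          (w k l' i j - w k l i j) - (w k l' i j' - w k l i j')"
        using p q by (simp add: wp wq)
      define d where "d s t = m i s k t + N i s k t - N k t i s" for s t
      \<comment> \<open>These terms depend on \<open>s\<close> alone or \<open>t\<close> alone, so
        they cancel in the alternating sum \<open>eq\<close>, leaving a relation between the
        integers \<open>d\<close>.\<close>
      define A B where "A s = arg_turns (b k - c i s) + 1 / 2" and "B t = arg_turns (b i - c k t)" for s t
      have "w i s k t = w k t i s + A s - B t + of_int (d s t)" if "s \<in> {j, j'}" "t \<in> {l, l'}" for s t
      proof -
        have "w i s k t = arg_turns (c i s - c k t) - arg_turns (b i - c k t) + of_int (N i s k t)"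
            "w k t i s = arg_turns (c k t - c i s) - arg_turns (b k - c i s) + of_int (N k t i s)"
            "arg_turns (c i s - c k t) = arg_turns (c k t - c i s) + 1 / 2 + of_int (m i s k t)"
          using w[of i s k t] w[of k t i s] m[of i s k t] ne that by (auto simp: diff_eq_eq ac_simps)
        then show ?thesis
          by (simp add: A_def B_def d_def)
      qed
      from this[of j l] this[of j' l] this[of j l'] this[of j' l'] eq
      have "of_int (d j' l + (d j l' + (- d j' l' - d j l))) = (of_int 0 :: complex)"
        by simp
      then have "d j' l + (d j l' + (- d j' l' - d j l)) = 0"
        by (simp only: of_int_eq_iff)
      moreover have "D i s k t = d s t + 2 * N k t i s" for s t
        by (simp add: D_def d_def)
      ultimately have "D i j' k l + D i j k l + D i j' k l' + D i j k l' =
          2 * (N k l i j' + N k l i j + N k l' i j' + N k l' i j + d j l + d j' l')"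
        by simp
      then show ?thesis
        by simp
    qed
  qed (auto simp: D_def N_sym m_sym)
qed

theorem theorem1p3:
  fixes \<F> :: "complex set set"
  assumes "\<forall>F\<in>\<F>. region F"
    and "non_piercing \<F>"
  shows "\<not> dyadic_witness \<F> 5"
proof
  assume "dyadic_witness \<F> 5"
  then obtain F :: "nat \<Rightarrow> complex set" and a where F: "\<And>i. i < 5 \<Longrightarrow> F i \<in> \<F>"
    and a: "\<And>i j. i < 5 \<Longrightarrow> j < 5 \<Longrightarrow> i \<noteq> j \<Longrightarrow>
      a i j \<in> F i \<and> a i j \<in> F j \<and> (\<forall>k<5. k \<noteq> i \<and> k \<noteq> j \<longrightarrow> a i j \<notin> F k)"
    unfolding dyadic_witness_def by metis
  \<comment> \<open>The witnesses \<open>a i j\<close> and \<open>a j i\<close> may differ; one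
    point per unordered pair is kept.\<close>
  define c where "c i j = a (min i j) (max i j)" for i j
  have c: "c i j \<in> F i \<and> (\<forall>k<5. k \<noteq> i \<and> k \<noteq> j \<longrightarrow> c i j \<notin> F k)" if "i < 5" "j < 5" "i \<noteq> j" for i j
    using a[OF that] a[of j i] that by (cases "i < j") (auto simp: c_def)
  show False
  proof (rule no_five_non_piercing_sets[of F c])
    show "path_connected (F i - F j)" if "i < 5" "j < 5" for i j
      using assms F that region_diff_path_connected unfolding non_piercing_def by blast
  qed (use assms F c region_path_connected in \<open>auto simp: c_def min.commute max.commute\<close>)
qed

end
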